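(* Let $F$ be an algebraically closed field of characteristic $0$, let $m\geqslant 2$, and let $\zeta\in F$ be a primitive $m$th root of unity. Let $L$ be a finite dimensional $H_{m^2}(\zeta)$-module Lie algebra over $F$. Suppose $L$ is simple in the ordinary sense (i.e. simple as a Lie algebra). Then $vL=0$.
   Context: The Taft algebra $H_{m^2}(\zeta)$ is the unital associative $F$-algebra generated by $c,v$ with relations $c^m=1$, $v^m=0$, $vc=\zeta cv$; it is a Hopf algebra with $\Delta(c)=c\otimes c$, $\Delta(v)=c\otimes v+v\otimes 1$, $\varepsilon(c)=1$, $\varepsilon(v)=0$, $S(c)=c^{-1}$, $S(v)=-c^{-1}v$. An $H_{m^2}(\zeta)$-module Lie algebra is a Lie algebra $L$ over $F$ that is a left $H_{m^2}(\zeta)$-module with $h[a,b]=[h_{(1)}a,h_{(2)}b]$ for all $h$ and all $a,b\in L$; in particular $c$ acts by a Lie automorphism and $v[a,b]=[ca,vb]+[va,b]$. *)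

theory Defs
  imports
    "HOL-Library.Poly_Mapping"
    "HOL-Library.Product_Plus"
    "HOL-Algebra.QuotRing"
    "HOL-Algebra.Algebraic_Closure_Type"
begin

section \<open>Free algebras\<close>

text \<open>
  Finitely supported functions on a monoid (written additively) form its monoid algebra. The free
  associative algebra on a set of letters is the monoid algebra of the monoid of words.
\<close>

datatype 'g word = Word (letters: "'g list")

instantiation word :: (type) monoid_add
begin

definition zero_word :: "'g word" where
  "zero_word = Word []"

definition plus_word :: "'g word \<Rightarrow> 'g word \<Rightarrow> 'g word" where
  "plus_word u w = Word (letters u @ letters w)"

instance
  by standard (simp_all add: zero_word_def plus_word_def)

end

type_synonym ('g, 'f) free_algebra = "'g word \<Rightarrow>\<^sub>0 'f"

definition letter :: "'g \<Rightarrow> ('g, 'f::field) free_algebra" where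
  "letter g = Poly_Mapping.single (Word [g]) 1"

definition scalar :: "'f \<Rightarrow> ('w::monoid_add \<Rightarrow>\<^sub>0 'f::field)" where
  "scalar k = Poly_Mapping.single 0 k"

text \<open>The unique unital algebra homomorphism out of the free algebra with prescribed values on the
  letters.\<close>

definition free_hom ::
  "('g \<Rightarrow> ('w::monoid_add \<Rightarrow>\<^sub>0 'f::field)) \<Rightarrow> ('g, 'f) free_algebra \<Rightarrow> ('w \<Rightarrow>\<^sub>0 'f)" where
  "free_hom \<phi> x =
     (\<Sum>w\<in>Poly_Mapping.keys x.
        scalar (Poly_Mapping.lookup x w) * prod_list (map \<phi> (letters w)))"

text \<open>The monoid algebra of a product of monoids is the tensor product of the two monoid algebras
  (with its usual multiplication); the word pair \<open>(u, w)\<close> stands for \<open>u \<otimes> w\<close>.\<close>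

definition tensor ::
  "('u \<Rightarrow>\<^sub>0 'f::field) \<Rightarrow> ('w \<Rightarrow>\<^sub>0 'f) \<Rightarrow> ('u \<times> 'w \<Rightarrow>\<^sub>0 'f)" where
  "tensor x y =
     (\<Sum>u\<in>Poly_Mapping.keys x. \<Sum>w\<in>Poly_Mapping.keys y.
        Poly_Mapping.single (u, w) (Poly_Mapping.lookup x u * Poly_Mapping.lookup y w))"


section \<open>The Taft algebra\<close>

definition primitive_root_of_unity :: "nat \<Rightarrow> 'f::field \<Rightarrow> bool" where
  "primitive_root_of_unity m \<zeta> \<longleftrightarrow> m > 0 \<and> \<zeta> ^ m = 1 \<and> (\<forall>k. 0 < k \<and> k < m \<longrightarrow> \<zeta> ^ k \<noteq> 1)"

datatype taft_gen = Gen_c | Gen_v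

definition taft_relators :: "nat \<Rightarrow> 'f::field \<Rightarrow> (taft_gen, 'f) free_algebra set" where
  "taft_relators m \<zeta> =
     {letter Gen_c ^ m - 1,
      letter Gen_v ^ m,
      letter Gen_v * letter Gen_c - scalar \<zeta> * (letter Gen_c * letter Gen_v)}"

definition taft_ideal :: "nat \<Rightarrow> 'f::field \<Rightarrow> (taft_gen, 'f) free_algebra set" where
  "taft_ideal m \<zeta> = Idl\<^bsub>ring_of_type_algebra\<^esub> (taft_relators m \<zeta>)"

definition taft_algebra :: "nat \<Rightarrow> 'f::field \<Rightarrow> (taft_gen, 'f) free_algebra set ring" where
  "taft_algebra m \<zeta> = ring_of_type_algebra Quot taft_ideal m \<zeta>"

definition taft_class ::
  "nat \<Rightarrow> 'f::field \<Rightarrow> (taft_gen, 'f) free_algebra \<Rightarrow> (taft_gen, 'f) free_algebra set" where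
  "taft_class m \<zeta> x = taft_ideal m \<zeta> +>\<^bsub>ring_of_type_algebra\<^esub> x"

definition taft_c :: "nat \<Rightarrow> 'f::field \<Rightarrow> (taft_gen, 'f) free_algebra set" where
  "taft_c m \<zeta> = taft_class m \<zeta> (letter Gen_c)"

definition taft_v :: "nat \<Rightarrow> 'f::field \<Rightarrow> (taft_gen, 'f) free_algebra set" where
  "taft_v m \<zeta> = taft_class m \<zeta> (letter Gen_v)"

text \<open>For the free algebra \<open>A\<close> and the ideal \<open>I\<close> of relations, the tensor square of \<open>H = A / I\<close> is
  \<open>H \<otimes> H = (A \<otimes> A) / (I \<otimes> A + A \<otimes> I)\<close>.\<close>

definition taft_tensor_ideal ::
  "nat \<Rightarrow> 'f::field \<Rightarrow> (taft_gen word \<times> taft_gen word \<Rightarrow>\<^sub>0 'f) set" where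
  "taft_tensor_ideal m \<zeta> =
     Idl\<^bsub>ring_of_type_algebra\<^esub>
       ((\<lambda>x. tensor x 1) ` taft_ideal m \<zeta> \<union> (\<lambda>x. tensor 1 x) ` taft_ideal m \<zeta>)"

definition taft_comult_free ::
  "(taft_gen, 'f::field) free_algebra \<Rightarrow> (taft_gen word \<times> taft_gen word \<Rightarrow>\<^sub>0 'f)" where
  "taft_comult_free =
     free_hom (\<lambda>g. case g of
         Gen_c \<Rightarrow> tensor (letter Gen_c) (letter Gen_c)
       | Gen_v \<Rightarrow> tensor (letter Gen_c) (letter Gen_v) + tensor (letter Gen_v) 1)"

text \<open>The comultiplication \<open>\<Delta> : H \<rightarrow> H \<otimes> H\<close>, which is the map that the homomorphism above induces on
  cosets. All members of the union are the same coset when \<open>\<zeta>\<close> is a primitive root of unity of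
  order \<open>m\<close>.\<close>

definition taft_comult ::
  "nat \<Rightarrow> 'f::field \<Rightarrow> (taft_gen, 'f) free_algebra set
     \<Rightarrow> (taft_gen word \<times> taft_gen word \<Rightarrow>\<^sub>0 'f) set" where
  "taft_comult m \<zeta> h =
     (\<Union>x\<in>h. taft_tensor_ideal m \<zeta> +>\<^bsub>ring_of_type_algebra\<^esub> taft_comult_free x)"


section \<open>Lie algebras\<close>

locale lie_algebra = vector_space scale
  for scale :: "'f::field \<Rightarrow> 'l::ab_group_add \<Rightarrow> 'l" +
  fixes bracket :: "'l \<Rightarrow> 'l \<Rightarrow> 'l"
  assumes bracket_add_left: "bracket (a + b) d = bracket a d + bracket b d"
    and bracket_add_right: "bracket a (b + d) = bracket a b + bracket a d"
    and bracket_scale_left: "bracket (scale k a) b = scale k (bracket a b)"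
    and bracket_scale_right: "bracket a (scale k b) = scale k (bracket a b)"
    and bracket_self: "bracket a a = 0"
    and jacobi:
      "bracket a (bracket b d) + bracket b (bracket d a) + bracket d (bracket a b) = 0"
begin

definition lie_ideal :: "'l set \<Rightarrow> bool" where
  "lie_ideal I \<longleftrightarrow> subspace I \<and> (\<forall>a. \<forall>b\<in>I. bracket a b \<in> I)"

end

locale simple_lie_algebra = lie_algebra +
  assumes not_abelian: "\<exists>a b. bracket a b \<noteq> 0"
    and lie_ideal_trivial: "lie_ideal I \<Longrightarrow> I = {0} \<or> I = UNIV"


section \<open>Module Lie algebras over the Taft algebra\<close>

text \<open>
  \<open>act h a\<close> is \<open>h a\<close>; it is relevant only for \<open>h\<close> in the carrier of the Taft algebra. In the last
  axiom \<open>t\<close> runs over the representatives of \<open>\<Delta>(h)\<close>. Each of them writes \<open>\<Delta>(h)\<close> as a linear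
  combination of tensors \<open>h' \<otimes> h''\<close> where \<open>h'\<close> and \<open>h''\<close> are the classes of words \<open>u\<close> and \<open>w\<close>; the
  right hand side is the corresponding linear combination of the brackets \<open>[h' a, h'' b]\<close>.
\<close>

locale taft_module_lie_algebra = lie_algebra scale bracket
  for m :: nat and \<zeta> :: "'f::field"
    and scale :: "'f \<Rightarrow> 'l::ab_group_add \<Rightarrow> 'l" and bracket :: "'l \<Rightarrow> 'l \<Rightarrow> 'l" +
  fixes act :: "(taft_gen, 'f) free_algebra set \<Rightarrow> 'l \<Rightarrow> 'l"
  assumes act_add_right:
      "h \<in> carrier (taft_algebra m \<zeta>) \<Longrightarrow> act h (a + b) = act h a + act h b"
    and act_add_left:
      "h \<in> carrier (taft_algebra m \<zeta>) \<Longrightarrow> g \<in> carrier (taft_algebra m \<zeta>) \<Longrightarrow>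
         act (h \<oplus>\<^bsub>taft_algebra m \<zeta>\<^esub> g) a = act h a + act g a"
    and act_mult:
      "h \<in> carrier (taft_algebra m \<zeta>) \<Longrightarrow> g \<in> carrier (taft_algebra m \<zeta>) \<Longrightarrow>
         act (h \<otimes>\<^bsub>taft_algebra m \<zeta>\<^esub> g) a = act h (act g a)"
    and act_one: "act \<one>\<^bsub>taft_algebra m \<zeta>\<^esub> a = a"
    and act_scalar: "act (taft_class m \<zeta> (scalar k)) a = scale k a"
    and act_bracket:
      "h \<in> carrier (taft_algebra m \<zeta>) \<Longrightarrow> t \<in> taft_comult m \<zeta> h \<Longrightarrow>
         act h (bracket a b) =
           (\<Sum>(u, w)\<in>Poly_Mapping.keys t.
              scale (Poly_Mapping.lookup t (u, w))
                (bracket (act (taft_class m \<zeta> (Poly_Mapping.single u 1)) a)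
                         (act (taft_class m \<zeta> (Poly_Mapping.single w 1)) b)))"

end

theory Submission
  imports Defs
begin

text \<open>
  Let \<open>C\<close> and \<open>V\<close> be the actions of \<open>c\<close> and \<open>v\<close>, and split \<open>L = L\<^sub>0 \<oplus> N\<close> with \<open>L\<^sub>0 = ker (C - 1)\<close> and
  \<open>N = range (C - 1)\<close>. Expanding \<open>V [a, b] = - V [b, a]\<close> gives \<open>[(C - 1) a, V b] = [V a, (C - 1) b]\<close>.
  Hence \<open>V L\<^sub>0\<close> centralizes \<open>N\<close>; since \<open>N + [N, N]\<close> is an ideal, \<open>V L\<^sub>0 = 0\<close>. Therefore
  \<open>W = V (C - 1)\<^sup>-\<^sup>1\<close> is well defined on \<open>N\<close>, satisfies \<open>[W a, b] = [a, W b]\<close> there and commutes with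
  \<open>ad L\<^sub>0\<close>. It extends to an element of the centroid of \<open>L\<close>. As the ground field is algebraically
  closed, \<open>W\<close> has an eigenvector and so is a scalar by simplicity; but \<open>W C = \<zeta> C W\<close> on \<open>N\<close>
  with \<open>\<zeta> \<noteq> 1\<close>, which forces the scalar to be \<open>0\<close>.
\<close>

section \<open>Eigenvectors over an algebraically closed field\<close>

text \<open>The \<open>dimension + 1\<close> vectors \<open>g 0\<close>, ..., \<open>g n\<close> are
  linearly dependent, and a relation between them supplies the coefficients of
  \<open>p\<close>.\<close>

lemma (in finite_dimensional_vector_space) exists_annihilating_poly:
  "\<exists>p. p \<noteq> 0 \<and> (\<Sum>k\<le>degree p. scale (coeff p k) (g k)) = 0"
proof -
  define n where "n = dimension"
  obtain u k0 where u: "(\<Sum>k\<le>n. scale (u k) (g k)) = 0" "k0 \<le> n" "u k0 \<noteq> 0"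
  \<comment> \<open>\<open>dependent\<close> speaks of sets, so a repeated vector has to yield its
    relation separately.\<close>
  proof (cases "inj_on g {..n}")
    case True
    have "dependent (g ` {..n})"
      using dim_subset_UNIV[of "g ` {..n}"] dim_eq_card_independent[of "g ` {..n}"] True
      by (auto simp: card_image n_def)
    then obtain v y where v: "(\<Sum>y\<in>g ` {..n}. scale (v y) y) = 0" "y \<in> g ` {..n}" "v y \<noteq> 0"
      using dependent_finite[of "g ` {..n}"] by auto
    then have "(\<Sum>k\<le>n. scale (v (g k)) (g k)) = 0"
      using True by (simp add: sum.reindex)
    with v that[of "\<lambda>k. v (g k)"] show ?thesis by auto
  next
    case False
    then obtain i j where ij: "i \<le> n" "j \<le> n" "i \<noteq> j" "g i = g j"
      by (auto simp: inj_on_def)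
    let ?u = "\<lambda>k. (if k = i then 1 else 0) - (if k = j then 1 else 0)"
    have "(\<Sum>k\<le>n. scale (?u k) (g k))
        = (\<Sum>k\<le>n. if k = i then g k else 0) - (\<Sum>k\<le>n. if k = j then g k else 0)"
      by (subst sum_subtractf[symmetric], rule sum.cong) (auto simp: scale_left_diff_distrib)
    also have "\<dots> = 0"
      using ij by simp
    finally show ?thesis
      using that[of ?u i] ij by simp
  qed
  define p where "p = (\<Sum>k\<le>n. monom (u k) k)"
  have cp: "coeff p k = (if k \<le> n then u k else 0)" for k
    by (simp add: p_def coeff_sum)
  have "p \<noteq> 0"
    using cp[of k0] u by auto
  have "degree p \<le> n"
    by (rule degree_le) (simp add: cp)
  then have "(\<Sum>k\<le>degree p. scale (coeff p k) (g k)) = (\<Sum>k\<le>n. scale (coeff p k) (g k))"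
    by (intro sum.mono_neutral_left) (auto simp: coeff_eq_0)
  also have "\<dots> = 0"
    using u(1) by (simp add: cp)
  finally show ?thesis
    using \<open>p \<noteq> 0\<close> by blast
qed

text \<open>Take a non-zero polynomial that annihilates \<open>x\<close> and split off a factor
  \<open>X - c\<close>. Either \<open>f y = c y\<close>, or the cofactor annihilates the non-zero
  vector \<open>f y - c y\<close>. The degree drops until the first case occurs, since a non-zero
  constant annihilates only \<open>0\<close>.\<close>

lemma exists_eigenvector:
  fixes scale :: "'f::alg_closed_field \<Rightarrow> 'l::ab_group_add \<Rightarrow> 'l"
  assumes "finite_dimensional_vector_space scale B"
    and f: "Vector_Spaces.linear scale scale f"
    and "(x :: 'l) \<noteq> 0"
  shows "\<exists>k y. y \<noteq> 0 \<and> f y = scale k y"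
proof -
  interpret finite_dimensional_vector_space scale B by fact
  interpret f: Vector_Spaces.linear scale scale f by fact
  \<comment> \<open>\<open>ev p y\<close> is \<open>p(f) y\<close>.\<close>
  define ev where "ev p y = (\<Sum>k\<le>degree p. scale (coeff p k) ((f ^^ k) y))" for p y
  have ev_pCons: "ev (pCons a p) y = scale a y + ev p (f y)" for a p y
  proof (cases "p = 0")
    case False
    then show ?thesis
      unfolding ev_def by (simp add: sum.atMost_Suc_shift funpow_swap1 del: sum.atMost_Suc)
  qed (auto simp: ev_def degree_pCons_eq_if)
  have powf: "(f ^^ k) (y - scale c z) = (f ^^ k) y - scale c ((f ^^ k) z)" for k c y z
    by (induction k) (simp_all add: f.diff f.scale)
  have ev_diff: "ev p (y - scale c z) = ev p y - scale c (ev p z)" for p c y z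
    by (simp add: ev_def powf scale_right_diff_distrib sum_subtractf scale_sum_right mult.commute)
  have ev_root: "ev ([:- c, 1:] * q) y = ev q (f y - scale c y)" for c q y
  proof -
    have "ev (pCons 0 q - smult c q) y = ev (pCons 0 q) y - scale c (ev q y)" for c
    proof -
      \<comment> \<open>Each sum in \<open>ev\<close> stops at the degree of its own polynomial; a
        common bound makes them comparable.\<close>
      define N where "N = Suc (degree q)"
      have ext: "ev p y = (\<Sum>k\<le>N. scale (coeff p k) ((f ^^ k) y))" if "degree p \<le> N" for p
        unfolding ev_def using that by (intro sum.mono_neutral_left) (auto simp: coeff_eq_0)
      have "degree (pCons 0 q) \<le> N" "degree q \<le> N" "degree (smult c q) \<le> N"
        by (simp_all add: N_def degree_pCons_le degree_smult_le le_SucI)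
      moreover from this have "degree (pCons 0 q - smult c q) \<le> N"
        by (meson degree_diff_le)
      ultimately show ?thesis
        by (simp add: ext scale_left_diff_distrib sum_subtractf scale_sum_right)
    qed
    moreover have "[:- c, 1:] * q = pCons 0 q - smult c q"
      by (simp add: mult_pCons_left)
    ultimately show ?thesis
      by (simp add: ev_pCons ev_diff)
  qed
  have "\<forall>y. y \<noteq> 0 \<longrightarrow> p \<noteq> 0 \<longrightarrow> ev p y = 0 \<longrightarrow> (\<exists>k z. z \<noteq> 0 \<and> f z = scale k z)" for p
  proof (induction "degree p" arbitrary: p rule: less_induct)
    case less
    show ?case
    proof (intro allI impI)
      fix y assume y: "y \<noteq> 0" "p \<noteq> 0" "ev p y = 0"
      have "degree p > 0"
      proof (rule ccontr)
        assume "\<not> degree p > 0"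
        then show False
          using y by (auto simp: ev_def elim: degree_eq_zeroE)
      qed
      then obtain c where "poly p c = 0"
        using alg_closed_imp_poly_has_root by blast
      then obtain q where p: "p = [:- c, 1:] * q"
        by (auto simp: poly_eq_0_iff_dvd dvd_def)
      have "q \<noteq> 0"
        using y p by auto
      then have "degree p = Suc (degree q)"
        unfolding p by (subst degree_mult_eq) auto
      then show "\<exists>k z. z \<noteq> 0 \<and> f z = scale k z"
        using less[of q] \<open>q \<noteq> 0\<close> y ev_root[of c q y] p
        by (metis eq_iff_diff_eq_0 lessI)
    qed
  qed
  moreover obtain p where "p \<noteq> 0" "ev p x = 0"
    using exists_annihilating_poly[of "\<lambda>k. (f ^^ k) x"] unfolding ev_def by blast
  ultimately show ?thesis
    using \<open>x \<noteq> 0\<close> by blast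
qed

section \<open>The action of the generators\<close>

lemma ring_ring_of_type_algebra: "ring (ring_of_type_algebra :: 'a::ring_1 ring)"
proof -
  have "\<exists>y. x + y = 0" for x :: 'a
    using add.right_inverse by blast
  then show ?thesis
    unfolding ring_of_type_algebra_def
    by unfold_locales (auto simp: algebra_simps Units_def)
qed

lemma free_hom_letter: "free_hom \<phi> (letter g) = \<phi> g"
  by (simp add: free_hom_def letter_def scalar_def single_one)

lemma tensor_single:
  "tensor (Poly_Mapping.single u a) (Poly_Mapping.single w b) = Poly_Mapping.single (u, w) (a * b)"
  by (simp add: tensor_def)

lemma scalar_commute: "x * scalar k = scalar k * x"
proof (induction x rule: update_induct)
  case (update f a b)
  have "Poly_Mapping.update a b f = Poly_Mapping.single a b + f"
    using update(1)
    by (intro poly_mapping_eqI) (auto simp: lookup_update lookup_add lookup_single when_def in_keys_iff)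
  then show ?case
    using update(3)
    by (simp add: algebra_simps scalar_def mult_single)
qed (simp add: scalar_def)

lemma abelian_subgroup_ideal:
  "ideal I (ring_of_type_algebra :: 'a::ring_1 ring) \<Longrightarrow> abelian_subgroup I ring_of_type_algebra"
  by (intro abelian_subgroupI3 ideal.axioms(1) ring.is_abelian_group ring_ring_of_type_algebra)

lemma additive_coset_self:
  assumes "ideal I (ring_of_type_algebra :: 'a::ring_1 ring)"
  shows "x \<in> I +>\<^bsub>ring_of_type_algebra\<^esub> x"
  using abelian_subgroup.a_rcos_self[OF abelian_subgroup_ideal[OF assms]]
  by (simp add: ring_of_type_algebra_def)

lemma additive_coset_eq_zero:
  assumes "ideal I (ring_of_type_algebra :: 'a::ring_1 ring)" and "x \<in> I"
  shows "I +>\<^bsub>ring_of_type_algebra\<^esub> x = I +>\<^bsub>ring_of_type_algebra\<^esub> 0"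
proof -
  have "0 \<in> I"
    using additive_subgroup.zero_closed[OF ideal.axioms(1)[OF assms(1)]]
    by (simp add: ring_of_type_algebra_def)
  with abelian_subgroup.a_rcos_const[OF abelian_subgroup_ideal[OF assms(1)]] assms(2)
  show ?thesis by simp
qed

context taft_module_lie_algebra
begin

abbreviation act_free :: "(taft_gen, 'f) free_algebra \<Rightarrow> 'l \<Rightarrow> 'l" where
  "act_free x \<equiv> act (taft_class m \<zeta> x)"

lemma ideal_taft_ideal: "ideal (taft_ideal m \<zeta>) ring_of_type_algebra"
  unfolding taft_ideal_def
  by (rule ring.genideal_ideal[OF ring_ring_of_type_algebra]) (simp add: ring_of_type_algebra_def)

lemma taft_class_hom: "taft_class m \<zeta> \<in> ring_hom ring_of_type_algebra (taft_algebra m \<zeta>)"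
  using ideal.rcos_ring_hom[OF ideal_taft_ideal]
  unfolding taft_algebra_def taft_class_def .

lemma taft_class_closed: "taft_class m \<zeta> x \<in> carrier (taft_algebra m \<zeta>)"
  by (rule ring_hom_closed[OF taft_class_hom]) (simp add: ring_of_type_algebra_def)

lemma act_free_add: "act_free (x + y) a = act_free x a + act_free y a"
  using ring_hom_add[OF taft_class_hom, of x y] act_add_left[OF taft_class_closed taft_class_closed]
  by (simp add: ring_of_type_algebra_def)

lemma act_free_mult: "act_free (x * y) a = act_free x (act_free y a)"
  using ring_hom_mult[OF taft_class_hom, of x y] act_mult[OF taft_class_closed taft_class_closed]
  by (simp add: ring_of_type_algebra_def)

lemma act_free_scalar: "act_free (scalar k) a = scale k a"
  by (rule act_scalar)

lemma act_free_one: "act_free 1 a = a"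
  using act_scalar[of 1] by (simp add: scalar_def single_one)

lemma act_free_power: "act_free (x ^ n) a = (act_free x ^^ n) a"
  by (induction n) (simp_all add: act_free_one act_free_mult)

lemma act_free_diff: "act_free (x - y) a = act_free x a - act_free y a"
  using act_free_add[of "x - y" y a] by simp

text \<open>Homogeneity holds because scalars are central in the free algebra and act by
  \<open>scale\<close>.\<close>

lemma linear_act_free: "Vector_Spaces.linear scale scale (act_free x)"
proof (unfold Vector_Spaces.linear_iff, intro conjI allI)
  show "act_free x (a + b) = act_free x a + act_free x b" for a b
    by (rule act_add_right[OF taft_class_closed])
  have "x * scalar k = scalar k * x" for k
    by (rule scalar_commute)
  then show "act_free x (scale k a) = scale k (act_free x a)" for k a
    by (metis act_free_mult act_free_scalar)
qed (unfold_locales)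

lemma act_free_eq_0:
  assumes "x \<in> taft_ideal m \<zeta>"
  shows "act_free x a = 0"
proof -
  have "taft_class m \<zeta> x = taft_class m \<zeta> 0"
    unfolding taft_class_def by (rule additive_coset_eq_zero[OF ideal_taft_ideal assms])
  then show ?thesis
    using act_free_diff[of 0 0 a] by simp
qed

lemma act_free_relator: "x \<in> taft_relators m \<zeta> \<Longrightarrow> act_free x a = 0"
  by (rule act_free_eq_0, unfold taft_ideal_def,
      rule subsetD[OF ring.genideal_self[OF ring_ring_of_type_algebra]])
    (simp_all add: ring_of_type_algebra_def)

lemma act_c_power: "(act (taft_c m \<zeta>) ^^ m) a = a"
  using act_free_relator[of "letter Gen_c ^ m - 1" a]
  by (simp add: taft_relators_def act_free_diff act_free_power act_free_one taft_c_def)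

lemma act_v_c: "act (taft_v m \<zeta>) (act (taft_c m \<zeta>) a)
    = scale \<zeta> (act (taft_c m \<zeta>) (act (taft_v m \<zeta>) a))"
  using act_free_relator[of "letter Gen_v * letter Gen_c - scalar \<zeta> * (letter Gen_c * letter Gen_v)" a]
  by (simp add: taft_relators_def act_free_diff act_free_mult act_free_scalar taft_c_def taft_v_def)

text \<open>The module axiom covers every representative of the coproduct;
  \<open>taft_comult_free x\<close> is one, as \<open>x\<close> lies in its own class.\<close>

lemma act_free_bracket:
  "act_free x (bracket a b) =
     (\<Sum>(u, w)\<in>Poly_Mapping.keys (taft_comult_free x).
        scale (Poly_Mapping.lookup (taft_comult_free x) (u, w))
          (bracket (act_free (Poly_Mapping.single u 1) a) (act_free (Poly_Mapping.single w 1) b)))"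
proof (rule act_bracket[OF taft_class_closed])
  have "ideal (taft_tensor_ideal m \<zeta>) ring_of_type_algebra"
    unfolding taft_tensor_ideal_def
    by (rule ring.genideal_ideal[OF ring_ring_of_type_algebra]) (simp add: ring_of_type_algebra_def)
  moreover have "x \<in> taft_class m \<zeta> x"
    unfolding taft_class_def by (rule additive_coset_self[OF ideal_taft_ideal])
  ultimately show "taft_comult_free x \<in> taft_comult m \<zeta> (taft_class m \<zeta> x)"
    unfolding taft_comult_def using additive_coset_self by blast
qed

lemma act_c_bracket:
  "act (taft_c m \<zeta>) (bracket a b) = bracket (act (taft_c m \<zeta>) a) (act (taft_c m \<zeta>) b)"
proof -
  have "taft_comult_free (letter Gen_c :: (taft_gen, 'f) free_algebra)
      = Poly_Mapping.single (Word [Gen_c], Word [Gen_c]) 1"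
    unfolding taft_comult_free_def free_hom_letter by (simp add: letter_def tensor_single)
  then show ?thesis
    unfolding taft_c_def by (subst act_free_bracket) (simp add: letter_def)
qed

lemma act_v_bracket:
  "act (taft_v m \<zeta>) (bracket a b)
     = bracket (act (taft_c m \<zeta>) a) (act (taft_v m \<zeta>) b) + bracket (act (taft_v m \<zeta>) a) b"
proof -
  let ?s = "Poly_Mapping.single (Word [Gen_c], Word [Gen_v]) (1::'f)"
  \<comment> \<open>The tensor factor \<open>1\<close> is the empty word, written \<open>0\<close>
    in the additive monoid of words.\<close>
  let ?t = "Poly_Mapping.single (Word [Gen_v], 0) (1::'f)"
  have "taft_comult_free (letter Gen_v :: (taft_gen, 'f) free_algebra) = ?s + ?t"
    unfolding taft_comult_free_def free_hom_letter
    by (simp add: letter_def tensor_single tensor_single[where w = 0 and b = 1, simplified])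
  moreover have "Poly_Mapping.keys (?s + ?t) = {(Word [Gen_c], Word [Gen_v]), (Word [Gen_v], 0)}"
    by (auto simp: in_keys_iff lookup_add lookup_single when_def split: if_splits)
  ultimately show ?thesis
    unfolding taft_c_def taft_v_def
    by (subst act_free_bracket)
      (simp add: letter_def lookup_add lookup_single when_def single_one act_free_one)
qed

end

section \<open>Operators of finite order\<close>

locale finite_order_operator = vector_space scale + f: Vector_Spaces.linear scale scale f
  for scale :: "'f::field \<Rightarrow> 'l::ab_group_add \<Rightarrow> 'l" and f :: "'l \<Rightarrow> 'l" +
  fixes m :: nat
  assumes of_nat_m: "of_nat m \<noteq> (0 :: 'f)" and power_m: "(f ^^ m) x = x"
begin

definition mean :: "'l \<Rightarrow> 'l" where
  "mean x = scale (1 / of_nat m) (\<Sum>k<m. (f ^^ k) x)"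

text \<open>The linear weights are chosen for summation by parts: up to \<open>mean\<close>, this is
  a right inverse of \<open>f - 1\<close>.\<close>

definition potential :: "'l \<Rightarrow> 'l" where
  "potential x = scale (1 / of_nat m) (\<Sum>k<m. scale (of_nat k) ((f ^^ k) x))"

lemma mean_fixed:
  assumes "f p = p"
  shows "mean p = p"
proof -
  have "(f ^^ k) p = p" for k
    by (induction k) (simp_all add: assms)
  then show ?thesis
    using of_nat_m by (simp add: mean_def sum_constant_scale)
qed

lemma commute_funpow:
  assumes "\<And>x. f (g x) = g (f x)"
  shows "(f ^^ k) (g x) = g ((f ^^ k) x)"
  by (induction k) (simp_all add: assms)

lemma funpow_add: "(f ^^ k) (a + b) = (f ^^ k) a + (f ^^ k) b"
  by (induction k) (simp_all add: f.add)

lemma funpow_scale: "(f ^^ k) (scale c a) = scale c ((f ^^ k) a)"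
  by (rule commute_funpow) (rule f.scale)

lemma linear_mean: "Vector_Spaces.linear scale scale mean"
  unfolding Vector_Spaces.linear_iff
  by (simp add: mean_def vector_space_axioms sum.distrib scale_right_distrib
      scale_sum_right mult.commute funpow_add funpow_scale)

lemma linear_potential: "Vector_Spaces.linear scale scale potential"
  unfolding Vector_Spaces.linear_iff
  by (simp add: potential_def vector_space_axioms sum.distrib scale_right_distrib
      scale_sum_right mult_ac funpow_add funpow_scale)

lemma potential_commute:
  assumes "Vector_Spaces.linear scale scale g" and fg: "\<And>x. f (g x) = g (f x)"
  shows "potential (g x) = g (potential x)"
proof -
  interpret g: Vector_Spaces.linear scale scale g by fact
  show ?thesis
    by (simp add: potential_def g.scale g.sum commute_funpow[where g = g, OF fg])
qed

lemma sum_funpow_Suc: "(\<Sum>k<m. (f ^^ Suc k) x) = (\<Sum>k<m. (f ^^ k) x)"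
  using sum.lessThan_Suc_shift[of "\<lambda>k. (f ^^ k) x" m] sum.lessThan_Suc[of "\<lambda>k. (f ^^ k) x" m]
  by (simp add: power_m)

lemma map_mean: "f (mean x) = mean x"
  using sum_funpow_Suc by (simp add: mean_def f.scale f.sum)

lemma mean_map: "mean (f x) = mean x"
  using sum_funpow_Suc by (simp add: mean_def funpow_swap1)

text \<open>Summation by parts, closed up by \<open>f ^^ m = id\<close>. Together with
  \<open>mean_map\<close> it identifies the kernel of \<open>mean\<close> with the range of
  \<open>f - 1\<close>.\<close>

lemma mean_potential: "mean x + (f (potential x) - potential x) = x"
proof -
  have "(\<Sum>k<n. scale (of_nat k) ((f ^^ Suc k) x)) - (\<Sum>k<n. scale (of_nat k) ((f ^^ k) x))
      = scale (of_nat n) ((f ^^ n) x) - (\<Sum>k<n. (f ^^ Suc k) x)" for n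
    by (induction n) (simp_all add: algebra_simps scale_left_distrib)
  from this[of m]
  have "(\<Sum>k<m. scale (of_nat k) ((f ^^ Suc k) x)) - (\<Sum>k<m. scale (of_nat k) ((f ^^ k) x))
      = scale (of_nat m) x - (\<Sum>k<m. (f ^^ k) x)"
    by (simp only: sum_funpow_Suc power_m)
  then have "f (potential x) - potential x
      = scale (1 / of_nat m) (scale (of_nat m) x - (\<Sum>k<m. (f ^^ k) x))"
    by (simp add: potential_def f.scale f.sum scale_right_diff_distrib[symmetric])
  then show ?thesis
    using of_nat_m by (simp add: mean_def scale_right_diff_distrib)
qed

end

section \<open>Elementary bracket identities and the centre\<close>

context lie_algebra
begin

lemma bracket_zero_left [simp]: "bracket 0 b = 0"
  using bracket_add_left[of 0 0 b] by simp

lemma bracket_zero_right [simp]: "bracket b 0 = 0"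
  using bracket_add_right[of b 0 0] by simp

lemma bracket_minus_left: "bracket (- a) b = - bracket a b"
  using bracket_add_left[of a "- a" b] by (simp add: eq_neg_iff_add_eq_0 add.commute)

lemma bracket_minus_right: "bracket a (- b) = - bracket a b"
  using bracket_add_right[of a b "- b"] by (simp add: eq_neg_iff_add_eq_0 add.commute)

lemma bracket_diff_left: "bracket (a - b) d = bracket a d - bracket b d"
  using bracket_add_left[of a "- b" d] by (simp add: bracket_minus_left)

lemma bracket_diff_right: "bracket a (b - d) = bracket a b - bracket a d"
  using bracket_add_right[of a b "- d"] by (simp add: bracket_minus_right)

lemma bracket_anti: "bracket a b = - bracket b a"
proof -
  have "bracket a b + bracket b a = bracket (a + b) (a + b)"
    unfolding bracket_add_left bracket_add_right unfolding bracket_self by (simp add: add.commute)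
  then show ?thesis
    unfolding bracket_self eq_neg_iff_add_eq_0 .
qed

lemma bracket_bracket_right:
  "bracket a (bracket b d) = bracket (bracket a b) d + bracket b (bracket a d)"
proof -
  have "bracket a (bracket b d) - bracket b (bracket a d) - bracket (bracket a b) d = 0"
    using jacobi[of a b d] bracket_anti[of d a] bracket_anti[of d "bracket a b"]
    by (simp add: bracket_minus_right)
  then show ?thesis by (simp add: algebra_simps)
qed

lemmas bracket_linear =
  bracket_add_left bracket_add_right bracket_diff_left bracket_diff_right
  bracket_minus_left bracket_minus_right bracket_scale_left bracket_scale_right

end

lemma (in simple_lie_algebra) central_eq_0:
  assumes "\<And>y. bracket z y = 0"
  shows "z = 0"
proof -
  have bracket_zero: "bracket a z = 0" if "\<forall>y. bracket z y = 0" for a z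
    using bracket_anti[of a z] that by simp
  let ?Z = "{z. \<forall>y. bracket z y = 0}"
  have "lie_ideal ?Z"
    unfolding lie_ideal_def subspace_def using bracket_zero
    by (auto simp: bracket_linear bracket_zero)
  moreover have "?Z \<noteq> UNIV"
    using not_abelian by auto
  ultimately have "?Z = {0}"
    using lie_ideal_trivial by blast
  with assms show ?thesis by auto
qed

section \<open>Skew derivations of simple Lie algebras\<close>

locale simple_skew_derivation = simple_lie_algebra scale bracket
  for scale :: "'f::field_char_0 \<Rightarrow> 'l::ab_group_add \<Rightarrow> 'l" (infixr "*s" 75)
    and bracket :: "'l \<Rightarrow> 'l \<Rightarrow> 'l" (infixl "\<bullet>" 70) +
  fixes m :: nat and \<zeta> :: 'f and C V :: "'l \<Rightarrow> 'l"
  assumes m_pos: "m > 0" and \<zeta>_neq_1: "\<zeta> \<noteq> 1"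
    and linear_C: "Vector_Spaces.linear scale scale C"
    and linear_V: "Vector_Spaces.linear scale scale V"
    and C_power: "(C ^^ m) x = x"
    and C_bracket: "C (a \<bullet> b) = C a \<bullet> C b"
    and V_C: "V (C a) = \<zeta> *s C (V a)"
    and V_bracket: "V (a \<bullet> b) = C a \<bullet> V b + V a \<bullet> b"
begin

sublocale C: finite_order_operator scale C m
  by (intro finite_order_operator.intro finite_order_operator_axioms.intro vector_space_axioms
      linear_C C_power) (use m_pos in simp)
sublocale V: Vector_Spaces.linear scale scale V by (rule linear_V)

section \<open>Fixed points of \<open>C\<close> and the complement \<open>ker E\<close>\<close>

abbreviation E :: "'l \<Rightarrow> 'l" where "E \<equiv> C.mean"
abbreviation T :: "'l \<Rightarrow> 'l" where "T \<equiv> C.potential"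

sublocale E: Vector_Spaces.linear scale scale E by (rule C.linear_mean)
sublocale T: Vector_Spaces.linear scale scale T by (rule C.linear_potential)

lemmas E_T = C.mean_potential
lemmas C_E = C.map_mean
lemmas E_C = C.mean_map
lemmas E_fixed = C.mean_fixed

lemma T_C: "T (C x) = C (T x)"
  by (rule C.potential_commute[OF linear_C]) simp

lemma E_C_diff: "E (C a - a) = 0"
  by (simp add: E.diff E_C)

lemma E_eq_0D: "E x = 0 \<Longrightarrow> C (T x) - T x = x"
  using E_T[of x] by simp

lemma decompose:
  obtains p n where "x = p + n" "C p = p" "E n = 0"
  using E_T[of x] C_E E_C_diff by metis

text \<open>Write \<open>n = (C - 1) (T n)\<close>; since \<open>C\<close> fixes \<open>p\<close>,
  the bracket is \<open>(C - 1) (p \<bullet> T n)\<close>.\<close>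

lemma E_bracket_fixed:
  assumes "C p = p" "E n = 0"
  shows "E (p \<bullet> n) = 0"
proof -
  have "p \<bullet> n = C (p \<bullet> T n) - p \<bullet> T n"
    using E_eq_0D[OF assms(2)] by (simp add: C_bracket assms(1) bracket_diff_right[symmetric])
  then show ?thesis by (metis E_C_diff)
qed

text \<open>With \<open>N = ker E\<close>, the span of \<open>N\<close> and \<open>[N, N]\<close> is
  a non-zero ideal, hence everything. Fixed points preserve \<open>N\<close> and act as derivations
  on \<open>[N, N]\<close>.\<close>

lemma generated:
  assumes sub: "subspace M"
    and N: "\<And>a. E a = 0 \<Longrightarrow> a \<in> M"
    and NN: "\<And>a b. E a = 0 \<Longrightarrow> E b = 0 \<Longrightarrow> a \<bullet> b \<in> M"
    and nontriv: "\<exists>a. E a = 0 \<and> a \<noteq> 0"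
  shows "x \<in> M"
proof -
  let ?G = "{a. E a = 0} \<union> {a \<bullet> b |a b. E a = 0 \<and> E b = 0}"
  have gen1: "a \<in> span ?G" if "E a = 0" for a
    using that by (intro span_base) auto
  have gen2: "a \<bullet> b \<in> span ?G" if "E a = 0" "E b = 0" for a b
    using that by (intro span_base) auto
  have gen: "y \<bullet> g \<in> span ?G" if "g \<in> ?G" for y g
  proof -
    obtain p n where y: "y = p + n" "C p = p" "E n = 0"
      by (rule decompose)
    from that consider "E g = 0" | a b where "g = a \<bullet> b" "E a = 0" "E b = 0"
      by auto
    then show ?thesis
    proof cases
      case 1
      then show ?thesis
        unfolding y bracket_add_left
        by (intro span_add gen1 gen2 E_bracket_fixed y)
    next
      case 2
      \<comment> \<open>For \<open>n \<bullet> g\<close> the inner bracket is split as well: its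
        fixed part maps \<open>n\<close> into \<open>N\<close>, and the rest gives an element of
        \<open>[N, N]\<close>.\<close>
      obtain p' n' where g: "g = p' + n'" "C p' = p'" "E n' = 0"
        by (rule decompose)
      have "p \<bullet> g = p \<bullet> a \<bullet> b + a \<bullet> (p \<bullet> b)"
        unfolding 2 by (rule bracket_bracket_right)
      then have "p \<bullet> g \<in> span ?G"
        by (simp only:) (intro span_add gen2 E_bracket_fixed y 2)
      moreover have "n \<bullet> g = - (p' \<bullet> n) + n \<bullet> n'"
        unfolding g bracket_add_right by (subst bracket_anti) simp
      then have "n \<bullet> g \<in> span ?G"
        by (simp only:) (intro span_add span_neg gen1 gen2 E_bracket_fixed y g)
      ultimately show ?thesis
        unfolding y(1) bracket_add_left by (rule span_add)
    qed
  qed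
  have "y \<bullet> g \<in> span ?G" if "g \<in> span ?G" for y g
    using that
  proof (induction rule: span_induct)
    case base
    show ?case
      unfolding subspace_def by (auto simp: bracket_linear span_zero intro: span_add span_scale)
  qed (rule gen)
  then have "lie_ideal (span ?G)"
    unfolding lie_ideal_def by blast
  moreover have "span ?G \<noteq> {0}"
    using nontriv gen1 by blast
  ultimately have "span ?G = UNIV"
    using lie_ideal_trivial by blast
  moreover have "span ?G \<subseteq> M"
    using N NN by (intro span_minimal sub) auto
  ultimately show ?thesis by blast
qed

text \<open>By Jacobi the centralizer of \<open>z\<close> also contains \<open>[N, N]\<close>, so
  \<open>z\<close> is central.\<close>

lemma centralizer_trivial:
  assumes z: "\<And>x. E x = 0 \<Longrightarrow> z \<bullet> x = 0" and "\<exists>a. E a = 0 \<and> a \<noteq> 0"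
  shows "z = 0"
proof (rule central_eq_0)
  fix y
  have "y \<in> {y. z \<bullet> y = 0}"
  proof (rule generated[OF _ _ _ assms(2)])
    show "a \<bullet> b \<in> {y. z \<bullet> y = 0}" if "E a = 0" "E b = 0" for a b
      using bracket_bracket_right[of z a b] that by (simp add: z)
  qed (auto simp: subspace_def bracket_linear z)
  then show "z \<bullet> y = 0" by simp
qed

section \<open>Vanishing of \<open>V\<close> on the fixed points of \<open>C\<close>\<close>

lemma C_diff_bracket_V: "(C a - a) \<bullet> V b = V a \<bullet> (C b - b)"
proof -
  have "C a \<bullet> V b + V a \<bullet> b = - (C b \<bullet> V a + V b \<bullet> a)"
    unfolding V_bracket[symmetric] by (subst bracket_anti) (rule V.neg)
  also have "\<dots> = V a \<bullet> C b + a \<bullet> V b"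
    using bracket_anti[of "C b" "V a"] bracket_anti[of "V b" a] by simp
  finally show ?thesis
    by (simp add: bracket_linear algebra_simps)
qed

lemma V_fixed:
  assumes "C p = p"
  shows "V p = 0"
proof (cases "\<exists>a. E a = 0 \<and> a \<noteq> 0")
  case True
  show ?thesis
  proof (rule centralizer_trivial[OF _ True])
    fix x assume "E x = 0"
    then show "V p \<bullet> x = 0"
      using C_diff_bracket_V[of p "T x"] E_eq_0D[of x] by (simp add: assms)
  qed
next
  case False
  \<comment> \<open>Here \<open>C\<close> is the identity, as the range of \<open>C - 1\<close> lies
    in \<open>ker E\<close>; the commutation rule then reads
    \<open>V p = \<zeta> *s V p\<close>.\<close>
  then have "C (V p) = V p"
    using E_C_diff[of "V p"] by auto
  then have "(1 - \<zeta>) *s V p = 0"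
    using V_C[of p] by (simp add: assms scale_left_diff_distrib)
  then show ?thesis
    using \<zeta>_neq_1 by simp
qed

text \<open>On \<open>ker E = range (C - 1)\<close> the potential inverts \<open>C - 1\<close>, so there \<open>W0 = V (C - 1)\<^sup>-\<^sup>1\<close>.\<close>

definition W0 :: "'l \<Rightarrow> 'l" where "W0 x = V (T x)"

sublocale W0: Vector_Spaces.linear scale scale W0
  unfolding Vector_Spaces.linear_iff
  by (simp add: vector_space_axioms W0_def T.add V.add T.scale V.scale)

text \<open>\<open>T (C a - a)\<close> differs from \<open>a\<close> only by the fixed point
  \<open>E a\<close>, which \<open>V\<close> kills.\<close>

lemma W0_C_diff: "W0 (C a - a) = V a"
proof -
  have "T (C a - a) = a - E a"
    using E_T[of a] by (simp add: T.diff T_C algebra_simps)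
  then show ?thesis
    by (simp add: W0_def V.diff V_fixed[OF C_E])
qed

lemma W0_C: "W0 (C x) = \<zeta> *s C (W0 x)"
  by (simp add: W0_def T_C V_C)

text \<open>On all of \<open>L\<close>, \<open>W0\<close> is thus the extension by zero from
  \<open>ker E\<close>.\<close>

lemma W0_E: "W0 (E x) = 0"
proof -
  have "W0 (E x) = W0 x - W0 (C (T x) - T x)"
    by (metis E_T W0.diff add_diff_cancel_right')
  then show ?thesis
    unfolding W0_C_diff by (simp add: W0_def)
qed

lemma W0_swap: "E a = 0 \<Longrightarrow> E b = 0 \<Longrightarrow> a \<bullet> W0 b = W0 a \<bullet> b"
  using C_diff_bracket_V[of "T a" "T b"] by (simp add: E_eq_0D W0_def)

text \<open>With \<open>p \<bullet> n = (C - 1) (p \<bullet> T n)\<close> the claim is the skew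
  Leibniz rule for \<open>V\<close>, where \<open>C p = p\<close> and
  \<open>V p = 0\<close>.\<close>

lemma W0_bracket_fixed:
  assumes "C p = p" "E n = 0"
  shows "W0 (p \<bullet> n) = p \<bullet> W0 n"
proof -
  have "p \<bullet> n = C (p \<bullet> T n) - p \<bullet> T n"
    using E_eq_0D[OF assms(2)] by (simp add: C_bracket assms(1) bracket_diff_right[symmetric])
  then have "W0 (p \<bullet> n) = V (p \<bullet> T n)"
    by (simp only: W0_C_diff)
  also have "\<dots> = p \<bullet> W0 n"
    by (simp add: V_bracket assms(1) V_fixed[OF assms(1)] W0_def)
  finally show ?thesis .
qed

text \<open>\<open>V = W0 (C - 1) = (\<zeta> C - 1) W0\<close>. Inserting this into the skew Leibniz
  rule, the cross terms cancel by \<open>W0_swap\<close>, and \<open>\<zeta> C - 1\<close> takes the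
  same value on \<open>W0 (a \<bullet> b)\<close> and on \<open>W0 a \<bullet> b\<close>.\<close>

lemma W0_bracket_defect:
  fixes a b
  defines "r \<equiv> W0 (a \<bullet> b) - W0 a \<bullet> b"
  assumes "E a = 0" "E b = 0"
  shows "\<zeta> *s C r = r"
proof -
  have V_W0: "V x = \<zeta> *s C (W0 x) - W0 x" for x
    using W0_C_diff[of x] by (simp add: W0.diff W0_C)
  have E: "E (C b) = 0"
    by (simp add: E_C assms)
  have "V (a \<bullet> b) = C a \<bullet> (\<zeta> *s C (W0 b)) - (C a \<bullet> W0 b - \<zeta> *s C (W0 a) \<bullet> b) - W0 a \<bullet> b"
    unfolding V_bracket V_W0[of a] V_W0[of b] by (simp add: bracket_linear algebra_simps)
  also have "C a \<bullet> W0 b = \<zeta> *s C (W0 a) \<bullet> b"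
    using W0_swap[of "C a" b] assms by (simp add: E_C W0_C)
  also have "C a \<bullet> (\<zeta> *s C (W0 b)) = \<zeta> *s C (W0 a \<bullet> b)"
    using W0_swap[of a b] assms by (simp add: bracket_linear C_bracket[symmetric])
  finally have "\<zeta> *s C (W0 (a \<bullet> b)) - W0 (a \<bullet> b) = \<zeta> *s C (W0 a \<bullet> b) - W0 a \<bullet> b"
    unfolding V_W0[of "a \<bullet> b"] diff_self diff_zero .
  then show ?thesis
    by (simp add: r_def C.f.diff scale_right_diff_distrib diff_eq_eq add_diff_eq)
qed

text \<open>The failure of \<open>[a, b] \<mapsto> [W0 a, b]\<close> to extend \<open>W0\<close> compatibly to brackets. It is an alternating
  form on \<open>ker E\<close>; moving \<open>C\<close> around its arguments shows that only the eigenvalue \<open>-1\<close> of \<open>C\<close>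
  contributes, and there the Jacobi identity gives \<open>2 S = 0\<close>.\<close>

definition S :: "'l \<Rightarrow> 'l \<Rightarrow> 'l \<Rightarrow> 'l" where
  "S a b x = W0 a \<bullet> b \<bullet> x - a \<bullet> b \<bullet> W0 x"

text \<open>Jacobi expands both terms, and \<open>W0_swap\<close> cancels
  \<open>b \<bullet> (W0 a \<bullet> x)\<close>. This form exposes the antisymmetry in
  \<open>b\<close> and \<open>x\<close>.\<close>

lemma S_eq:
  assumes "E a = 0" "E b = 0" "E x = 0"
  shows "S a b x = W0 a \<bullet> (b \<bullet> x) - a \<bullet> (W0 b \<bullet> x)"
  using bracket_bracket_right[of "W0 a" b x] bracket_bracket_right[of a b "W0 x"]
    W0_swap[OF assms(1,3)] W0_swap[OF assms(2,3)]
  by (simp add: S_def)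

lemma S_anti12:
  assumes "E a = 0" "E b = 0"
  shows "S a b x = - S b a x"
proof -
  have "W0 a \<bullet> b = - (W0 b \<bullet> a)"
    using W0_swap[OF assms] bracket_anti[of a "W0 b"] by simp
  then show ?thesis
    using bracket_anti[of a b] by (simp add: S_def bracket_linear)
qed

lemma S_anti23:
  assumes "E a = 0" "E b = 0" "E x = 0"
  shows "S a b x = - S a x b"
proof -
  have "W0 b \<bullet> x = - (W0 x \<bullet> b)"
    using W0_swap[OF assms(2,3)] bracket_anti[of b "W0 x"] by simp
  then show ?thesis
    using bracket_anti[of b x] by (simp add: S_eq assms bracket_linear)
qed

text \<open>Split \<open>b \<bullet> x\<close> by \<open>E\<close> and move \<open>W0\<close> across
  the part in \<open>ker E\<close>. What remains depends on \<open>E (b \<bullet> x)\<close>, which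
  is invariant under \<open>C\<close>, and on the defect of \<open>W0\<close>, which is invariant
  under \<open>\<zeta> C\<close>.\<close>

lemma S_C23:
  assumes "E a = 0" "E b = 0" "E x = 0"
  shows "S a (C b) (C x) = S a b x"
proof -
  have eq: "S a b x = W0 a \<bullet> E (b \<bullet> x) + a \<bullet> (W0 (b \<bullet> x) - W0 b \<bullet> x)"
    if "E b = 0" "E x = 0" for b x
  proof -
    let ?n = "b \<bullet> x - E (b \<bullet> x)"
    have "E ?n = 0"
      by (simp add: E.diff E_fixed C_E)
    then have "W0 a \<bullet> ?n = a \<bullet> W0 (b \<bullet> x)"
      using W0_swap[OF assms(1), of ?n] by (simp add: W0.diff W0_E)
    then show ?thesis
      by (simp add: S_eq assms(1) that bracket_linear algebra_simps)
  qed
  have "W0 (C b \<bullet> C x) - W0 (C b) \<bullet> C x = \<zeta> *s C (W0 (b \<bullet> x) - W0 b \<bullet> x)"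
    by (simp add: C_bracket[symmetric] W0_C C.f.diff bracket_linear scale_right_diff_distrib)
  also have "\<dots> = W0 (b \<bullet> x) - W0 b \<bullet> x"
    by (rule W0_bracket_defect[OF assms(2,3)])
  finally show ?thesis
    using assms by (simp add: eq E_C C_bracket[symmetric])
qed

lemma S_add: "S (a + a') b x = S a b x + S a' b x"
  by (simp add: S_def W0.add bracket_linear)

text \<open>As \<open>S\<close> is alternating, \<open>C\<close> may be applied to any two
  arguments. Using the pairs (1,2), (2,3) and (1,3) in turn leaves \<open>C\<close> applied twice to
  the first argument.\<close>

lemma S_C2:
  assumes N: "E a = 0" "E b = 0" "E x = 0"
  shows "S (C (C a)) b x = S a b x"
proof -
  have C12: "S (C a) (C b) x = S a b x" if "E a = 0" "E b = 0" "E x = 0" for a b x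
  proof -
    have "S (C a) (C b) x = S x (C a) (C b)" "S a b x = S x a b"
      using that S_anti12 S_anti23 by (metis E_C minus_minus)+
    then show ?thesis using S_C23[of x a b] that by simp
  qed
  have C13: "S (C a) b (C x) = S a b x" if "E a = 0" "E b = 0" "E x = 0" for a b x
    using that C12[of a x b] S_anti23 by (metis E_C)
  \<comment> \<open>\<open>C ^^ (m - 1)\<close> inverts \<open>C\<close> and preserves
    \<open>ker E\<close>.\<close>
  obtain b' where b': "b = C b'" "E b' = 0"
  proof
    show "b = C ((C ^^ (m - 1)) b)"
      using C_power[of b] m_pos by (metis Suc_pred' comp_apply funpow.simps(2))
    then show "E ((C ^^ (m - 1)) b) = 0"
      using N E_C by metis
  qed
  have "S (C (C a)) (C b') x = S (C a) b' x"
    using N b' by (simp add: C12 E_C)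
  also have "\<dots> = S (C a) (C b') (C x)"
    using N b' by (simp add: S_C23 E_C)
  also have "\<dots> = S a b x"
    using N b' by (simp add: C13 E_C)
  finally show ?thesis
    using b' by simp
qed

text \<open>Average \<open>a\<close> over the powers of \<open>D = C \<circ> C\<close>: the
  difference lies in the range of \<open>D - 1\<close>, where \<open>S_C2\<close> makes
  \<open>S\<close> vanish.\<close>

lemma S_reduce:
  assumes "E a = 0"
  obtains a' where "E a' = 0" "C a' = - a'" "\<And>b x. E b = 0 \<Longrightarrow> E x = 0 \<Longrightarrow> S a b x = S a' b x"
proof -
  define D where "D = C \<circ> C"
  have D: "Vector_Spaces.linear scale scale D"
    unfolding Vector_Spaces.linear_iff
    by (simp add: vector_space_axioms D_def C.f.add C.f.scale)
  have Dm: "(D ^^ m) x = x" for x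
  proof -
    have "(D ^^ k) x = (C ^^ k) ((C ^^ k) x)" for k
      by (induction k) (simp_all add: D_def funpow_swap1)
    then show ?thesis by (simp add: C_power)
  qed
  interpret D: finite_order_operator scale D m
    by (intro finite_order_operator.intro finite_order_operator_axioms.intro vector_space_axioms D Dm)
      (use m_pos in simp)
  define a' where "a' = D.mean a"
  define y where "y = D.potential a"
  have a: "a = a' + (D y - y)"
    unfolding a'_def y_def by (rule D.mean_potential[symmetric])
  interpret P: Vector_Spaces.linear scale scale D.potential by (rule D.linear_potential)
  have "E y = D.potential (E a)"
    unfolding y_def
    by (rule D.potential_commute[OF C.linear_mean, symmetric]) (simp add: D_def E_C C_E)
  then have y: "E y = 0"
    using assms P.zero by simp
  have Ea': "E a' = 0"
    using assms a by (simp add: E.diff E.add D_def E_C y)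
  have "D a' = a'"
    unfolding a'_def by (rule D.map_mean)
  \<comment> \<open>A fixed point of \<open>C\<close> lying in \<open>ker E\<close> is
    \<open>0\<close>.\<close>
  then have "C (C a' + a') = C a' + a'"
    by (simp add: D_def C.f.add)
  then have "C a' + a' = 0"
    using E_fixed[of "C a' + a'"] by (simp add: E.add E_C Ea')
  then have "C a' = - a'"
    by (simp add: eq_neg_iff_add_eq_0)
  moreover have "S a b x = S a' b x" if "E b = 0" "E x = 0" for b x
  proof -
    have "S (D y) b x = S y b x"
      unfolding D_def o_def by (rule S_C2[OF y that])
    moreover have "D y = (D y - y) + y" by simp
    ultimately have "S (D y - y) b x = 0"
      using S_add[of "D y - y" y b x] by simp
    then show ?thesis
      using S_add[of a' "D y - y" b x] a by simp
  qed
  ultimately show thesis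
    using that Ea' by blast
qed

text \<open>Brackets of two arguments are fixed by \<open>C\<close>, so applying \<open>W0\<close>
  to the Jacobi identity gives \<open>1\<close>. Hence the cyclic sum of \<open>S\<close> equals
  \<open>S a b x\<close> by \<open>2\<close>; it is also \<open>3 S a b x\<close> by
  antisymmetry.\<close>

lemma S_antifixed:
  assumes N: "E a = 0" "E b = 0" "E x = 0" and C: "C a = - a" "C b = - b" "C x = - x"
  shows "S a b x = 0"
proof -
  have U: "W0 u \<bullet> (v \<bullet> y) = W0 (u \<bullet> (v \<bullet> y))"
    if "E u = 0" "C v = - v" "C y = - y" for u v y
  proof -
    have "C (v \<bullet> y) = v \<bullet> y"
      by (simp add: C_bracket that bracket_linear)
    from W0_bracket_fixed[OF this \<open>E u = 0\<close>] show ?thesis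
      by (simp add: bracket_anti[of _ "v \<bullet> y"] W0.neg)
  qed
  have 1: "W0 a \<bullet> (b \<bullet> x) + W0 b \<bullet> (x \<bullet> a) + W0 x \<bullet> (a \<bullet> b) = 0"
    using jacobi[of a b x] by (simp add: U N C W0.add[symmetric])
  have 2: "S a b x = - (a \<bullet> (W0 b \<bullet> x) + b \<bullet> (W0 x \<bullet> a) + x \<bullet> (W0 a \<bullet> b))"
  proof -
    have "b \<bullet> (x \<bullet> W0 a) = b \<bullet> (W0 x \<bullet> a)"
      by (simp add: W0_swap N)
    then have "W0 a \<bullet> (b \<bullet> x) = - (b \<bullet> (W0 x \<bullet> a) + x \<bullet> (W0 a \<bullet> b))"
      using jacobi[of "W0 a" b x] by (simp only: eq_neg_iff_add_eq_0 add.assoc)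
    then show ?thesis
      by (simp add: S_eq[OF N])
  qed
  have "S a b x + S b x a + S x a b
      = - (a \<bullet> (W0 b \<bullet> x) + b \<bullet> (W0 x \<bullet> a) + x \<bullet> (W0 a \<bullet> b))"
    using 1 by (simp add: S_eq N algebra_simps)
  moreover have "S b x a = S a b x" "S x a b = S a b x"
    using N S_anti12 S_anti23 by (metis minus_minus)+
  ultimately have "2 *s S a b x = 0"
    using 2 by (metis add_cancel_left_right add.assoc scale_left_distrib one_add_one scale_one)
  then show ?thesis by simp
qed

lemma S_eq_0:
  assumes N: "E a = 0" "E b = 0" "E x = 0"
  shows "S a b x = 0"
proof -
  obtain a' where a': "E a' = 0" "C a' = - a'" "\<And>b x. E b = 0 \<Longrightarrow> E x = 0 \<Longrightarrow> S a b x = S a' b x"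
    using S_reduce[OF N(1)] by blast
  obtain b' where b': "E b' = 0" "C b' = - b'" "\<And>a x. E a = 0 \<Longrightarrow> E x = 0 \<Longrightarrow> S b a x = S b' a x"
    using S_reduce[OF N(2)] by blast
  obtain x' where x': "E x' = 0" "C x' = - x'" "\<And>a b. E a = 0 \<Longrightarrow> E b = 0 \<Longrightarrow> S x a b = S x' a b"
    using S_reduce[OF N(3)] by blast
  \<comment> \<open>Cyclic rotations bring each argument in turn to the first slot, where
    \<open>S_reduce\<close> applies.\<close>
  have "S a b x = S x a b"
    using N S_anti12 S_anti23 by (metis minus_minus)
  also have "\<dots> = S b x' a"
    using N x' S_anti12 S_anti23 by (metis minus_minus)
  also have "\<dots> = S a b' x'"
    using N x' b' S_anti12 S_anti23 by (metis minus_minus)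
  also have "\<dots> = S a' b' x'"
    using a' b' x' by simp
  also have "\<dots> = 0"
    using a' b' x' by (intro S_antifixed)
  finally show ?thesis .
qed

section \<open>Extension of \<open>W0\<close> to an element of the centroid\<close>

context
  assumes nontriv: "\<exists>a. E a = 0 \<and> a \<noteq> 0"
begin

text \<open>The admissible \<open>p\<close> form a subspace. It contains \<open>ker E\<close>, with
  \<open>q = W0 p\<close>, and the brackets \<open>a \<bullet> b\<close>, with
  \<open>q = W0 a \<bullet> b\<close> because \<open>S\<close> vanishes; \<open>generated\<close>
  finishes.\<close>

lemma W_ex: "\<exists>q. \<forall>x. E x = 0 \<longrightarrow> q \<bullet> x = p \<bullet> W0 x"
proof -
  let ?M = "{p. \<exists>q. \<forall>x. E x = 0 \<longrightarrow> q \<bullet> x = p \<bullet> W0 x}"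
  have "p \<in> ?M"
  proof (rule generated[OF _ _ _ nontriv])
    show "subspace ?M"
      unfolding subspace_def
    proof (intro conjI ballI allI)
      show "0 \<in> ?M" by (auto intro: exI[of _ 0])
      fix p p' k assume "p \<in> ?M"
      then obtain q where q: "\<And>x. E x = 0 \<Longrightarrow> q \<bullet> x = p \<bullet> W0 x" by blast
      then show "k *s p \<in> ?M"
        by (auto simp: bracket_linear intro!: exI[of _ "k *s q"])
      assume "p' \<in> ?M"
      then obtain q' where q': "\<And>x. E x = 0 \<Longrightarrow> q' \<bullet> x = p' \<bullet> W0 x" by blast
      with q show "p + p' \<in> ?M"
        by (auto simp: bracket_linear intro!: exI[of _ "q + q'"])
    qed
    show "a \<in> ?M" if "E a = 0" for a
      using that W0_swap[of a] by (auto intro!: exI[of _ "W0 a"])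
    show "a \<bullet> b \<in> ?M" if "E a = 0" "E b = 0" for a b
      using S_eq_0[OF that] by (auto simp: S_def intro!: exI[of _ "W0 a \<bullet> b"])
  qed
  then show ?thesis by simp
qed

text \<open>The choice is unique by \<open>centralizer_trivial\<close>. Describing
  \<open>W p\<close> by its brackets with \<open>ker E\<close> avoids well-definedness questions
  about sums of brackets.\<close>

definition W :: "'l \<Rightarrow> 'l" where
  "W p = (SOME q. \<forall>x. E x = 0 \<longrightarrow> q \<bullet> x = p \<bullet> W0 x)"

lemma W_bracket_left: "E x = 0 \<Longrightarrow> W p \<bullet> x = p \<bullet> W0 x"
  using someI_ex[OF W_ex[of p]] unfolding W_def by blast

lemma W_eqI:
  assumes "\<And>x. E x = 0 \<Longrightarrow> q \<bullet> x = p \<bullet> W0 x"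
  shows "W p = q"
proof -
  have "W p - q = 0"
    by (rule centralizer_trivial[OF _ nontriv]) (simp add: bracket_linear W_bracket_left assms)
  then show ?thesis by simp
qed

lemma linear_W: "Vector_Spaces.linear scale scale W"
  unfolding Vector_Spaces.linear_iff
  by (intro conjI allI W_eqI) (simp_all add: bracket_linear W_bracket_left vector_space_axioms)

lemma W_eq_W0: "E a = 0 \<Longrightarrow> W a = W0 a"
  by (rule W_eqI) (simp add: W0_swap)

text \<open>For \<open>y\<close> in \<open>ker E\<close>, split \<open>p\<close>: the fixed part is
  handled by \<open>W0_bracket_fixed\<close>, the other by the vanishing of \<open>S\<close>. Jacobi
  passes to \<open>y = a \<bullet> b\<close>, and \<open>generated\<close> to all
  \<open>y\<close>.\<close>

lemma W_bracket: "W (p \<bullet> y) = W p \<bullet> y"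
proof -
  interpret W: Vector_Spaces.linear scale scale W by (rule linear_W)
  have N: "W (p \<bullet> y) = W p \<bullet> y" if y: "E y = 0" for p y
  proof -
    obtain p' n where p: "p = p' + n" "C p' = p'" "E n = 0"
      by (rule decompose)
    have "W (p' \<bullet> y) = W p' \<bullet> y"
      using W_eq_W0[OF E_bracket_fixed[OF p(2) y]] W0_bracket_fixed[OF p(2) y]
      by (simp add: W_bracket_left y)
    moreover have "W (n \<bullet> y) = W n \<bullet> y"
      unfolding W_eq_W0[OF p(3)]
      by (rule W_eqI) (use S_eq_0[OF p(3) y] in \<open>simp add: S_def\<close>)
    ultimately show ?thesis
      by (simp add: p(1) bracket_linear W.add)
  qed
  have "y \<in> {y. \<forall>p. W (p \<bullet> y) = W p \<bullet> y}"
  proof (rule generated[OF _ _ _ nontriv])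
    show "a \<bullet> b \<in> {y. \<forall>p. W (p \<bullet> y) = W p \<bullet> y}" if "E a = 0" "E b = 0" for a b
    proof -
      have "W (p \<bullet> (a \<bullet> b)) = W p \<bullet> (a \<bullet> b)" for p
      proof -
        have eq: "q \<bullet> (a \<bullet> b) = q \<bullet> a \<bullet> b - q \<bullet> b \<bullet> a" for q
          using bracket_bracket_right[of q a b] bracket_anti[of a "q \<bullet> b"] by simp
        show ?thesis
          unfolding eq W.diff using that by (simp add: N)
      qed
      then show ?thesis by simp
    qed
  qed (use N in \<open>auto simp: subspace_def bracket_linear W.add W.scale\<close>)
  then show ?thesis by simp
qed

text \<open>Eigenspaces of a centroid element are ideals, so \<open>W\<close> is a scalar
  \<open>k\<close>. Comparing with \<open>W0_C\<close> at a non-zero vector of \<open>ker E\<close>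
  gives \<open>k = \<zeta> k\<close>.\<close>

lemma W_eq_0_if_eigenvector:
  assumes "x \<noteq> 0" "W x = k *s x"
  shows "W y = 0"
proof -
  interpret W: Vector_Spaces.linear scale scale W by (rule linear_W)
  let ?I = "{p. W p = k *s p}"
  have "lie_ideal ?I"
    unfolding lie_ideal_def subspace_def
  proof (intro conjI allI ballI)
    fix a b assume "b \<in> ?I"
    then have "W (b \<bullet> a) = k *s (b \<bullet> a)"
      by (simp add: W_bracket bracket_linear)
    then show "a \<bullet> b \<in> ?I"
      by (simp add: bracket_anti[of a b] W.neg)
  qed (auto simp: W.add W.scale scale_right_distrib mult.commute)
  then have "?I = UNIV"
    using lie_ideal_trivial assms by blast
  then have W: "W p = k *s p" for p by auto
  obtain a where a: "E a = 0" "a \<noteq> 0"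
    using nontriv by blast
  have "W0 a = k *s a" "W0 (C a) = k *s C a"
    using W_eq_W0 a by (simp_all add: W[symmetric] E_C)
  then have "k *s C a = \<zeta> *s k *s C a"
    using W0_C[of a] by (simp add: C.f.scale)
  then have "((1 - \<zeta>) * k) *s C a = 0"
    by (simp add: algebra_simps scale_left_diff_distrib)
  moreover have "C a \<noteq> 0"
  proof
    assume "C a = 0"
    then have "(C ^^ Suc (m - 1)) a = 0"
      using C.funpow_scale[of "m - 1" 0] by (simp add: funpow_swap1)
    then show False
      using C_power[of a] m_pos a by simp
  qed
  ultimately have "k = 0"
    using \<zeta>_neq_1 by simp
  then show ?thesis by (simp add: W)
qed

lemma V_eq_0_if_eigenvector:
  assumes "x \<noteq> 0" "W x = k *s x"
  shows "V y = 0"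
proof -
  have "V y = W0 (C y - y)"
    by (rule W0_C_diff[symmetric])
  also have "\<dots> = W (C y - y)"
    by (rule W_eq_W0[OF E_C_diff, symmetric])
  also have "\<dots> = 0"
    by (rule W_eq_0_if_eigenvector[OF assms])
  finally show ?thesis .
qed

end

text \<open>The hypothesis \<open>ex\<close> is the point where finite dimension and algebraic
  closedness enter.\<close>

lemma V_eq_0_if_eigenvectors:
  assumes ex: "\<And>f (x :: 'l). Vector_Spaces.linear scale scale f \<Longrightarrow> x \<noteq> 0 \<Longrightarrow> \<exists>k y. y \<noteq> 0 \<and> f y = k *s y"
  shows "V a = 0"
proof (cases "\<exists>a. E a = 0 \<and> a \<noteq> 0")
  case True
  then obtain x where "E x = 0 \<and> x \<noteq> 0" ..
  then have "\<exists>k y. y \<noteq> 0 \<and> W y = k *s y"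
    by (intro ex[OF linear_W[OF True], of x]) (rule conjunct2)
  then obtain k y where "y \<noteq> 0" "W y = k *s y"
    by (elim exE conjE)
  then show ?thesis
    by (rule V_eq_0_if_eigenvector[OF True])
next
  case False
  then have "z = 0" if "E z = 0" for z
    using that by blast
  from this[OF E_C_diff] have "C a - a = 0" .
  then show ?thesis
    by (intro V_fixed) simp
qed

end

section \<open>Application to the actions of \<open>c\<close> and \<open>v\<close>\<close>

theorem theorem4p11:
  fixes m :: nat and \<zeta> :: "'f :: {alg_closed_field, field_char_0}"
    and scale :: "'f \<Rightarrow> 'l::ab_group_add \<Rightarrow> 'l"
    and bracket :: "'l \<Rightarrow> 'l \<Rightarrow> 'l"
    and act :: "(taft_gen, 'f) free_algebra set \<Rightarrow> 'l \<Rightarrow> 'l"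
  assumes "m \<ge> 2"
    and "primitive_root_of_unity m \<zeta>"
    and "taft_module_lie_algebra m \<zeta> scale bracket act"
    and "\<exists>B. finite_dimensional_vector_space scale B"
    and "simple_lie_algebra scale bracket"
  shows "range (act (taft_v m \<zeta>)) = {0}"
proof -
  obtain B where B: "finite_dimensional_vector_space scale B"
    using assms(4) by blast
  interpret M: taft_module_lie_algebra m \<zeta> scale bracket act
    by (rule assms(3))
  interpret L: simple_lie_algebra scale bracket
    by (rule assms(5))
  let ?C = "act (taft_c m \<zeta>)" and ?V = "act (taft_v m \<zeta>)"
  \<comment> \<open>Primitivity at the exponent \<open>1\<close> gives
    \<open>\<zeta> \<noteq> 1\<close>.\<close>
  have "0 < (1::nat) \<and> 1 < m"
    using assms(1) by simp
  then have "\<zeta> \<noteq> 1"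
    using assms(2) unfolding primitive_root_of_unity_def by (metis power_one_right)
  then have "simple_skew_derivation_axioms scale bracket m \<zeta> ?C ?V"
    using assms(1)
    by (simp add: simple_skew_derivation_axioms_def M.act_c_power M.act_c_bracket M.act_v_c
        M.act_v_bracket M.linear_act_free[of "letter Gen_c", folded taft_c_def]
        M.linear_act_free[of "letter Gen_v", folded taft_v_def])
  then interpret D: simple_skew_derivation scale bracket m \<zeta> ?C ?V
    by (rule simple_skew_derivation.intro[OF assms(5)])
  have "?V a = 0" for a
    by (rule D.V_eq_0_if_eigenvectors) (rule exists_eigenvector[OF B])
  then show ?thesis by auto
qed

end
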